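(* Let $R>0$, let $J$ satisfy: $J\in C(\mathbb{R})$, $J\ge 0$, $\int_{\mathbb{R}}J=1$, and there exist $a<0<b$ with $J(a)>0$ and $J(b)>0$. Let $f:\mathbb{R}\times[0,\infty)\to\mathbb{R}$ satisfy: $f$ is continuous on $\mathbb{R}\times[0,\infty)$ and differentiable with respect to $u$; for each $u$, $f(\cdot,u)$ is periodic with period $2R$; $f_u(\cdot,0)$ is Lipschitz; $f(\cdot,0)\equiv 0$ and, for each $x$, $u\mapsto f(x,u)/u$ is (strictly) decreasing on $(0,\infty)$; and there exists $M>0$ such that $f(x,u)\le 0$ for all $u\ge M$ and all $x$. Let $\mathcal{M}[u]=J\star u-u$, and let $\lambda_1$ be the principal eigenvalue of the linear operator $-(\mathcal{M}+f_u(x,0))$ in the set of $2R$-periodic continuous functions. Then there exists a nontrivial, $2R$-periodic solution of $$\mathcal{M}[u]+f(x,u)=0\quad\text{in }\mathbb{R}$$ if and only if $\lambda_1<0$. Moreover, if $\lambda_1\ge 0$, then any nonnegative bounded solution of this equation is identically zero.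
   Context: Convolution: $(J\star u)(x)=\int_{\mathbb{R}}J(x-y)u(y)\,dy$. Solutions of $\mathcal{M}[u]+f(x,u)=0$ are nonnegative bounded measurable functions $u:\mathbb{R}\to[0,\infty)$ satisfying the equation almost everywhere (they need not be continuous); equality of such functions is understood almost everywhere, and nontrivial means not identically zero. Principal eigenvalue: let $C_{per}(\mathbb{R})$ be the space of continuous $2R$-periodic functions $\mathbb{R}\to\mathbb{R}$. For a Lipschitz $2R$-periodic function $a$, the principal eigenvalue of $-(\mathcal{M}+a(x))$ in $C_{per}(\mathbb{R})$ is the unique $\lambda_1\in\mathbb{R}$ for which there is a positive $\phi_1\in C_{per}(\mathbb{R})$ with $\mathcal{M}[\phi_1]+a(x)\phi_1=-\lambda_1\phi_1$ in $\mathbb{R}$ (existence and uniqueness of such a $\lambda_1$ hold whenever $J\in C(\mathbb{R})$, $J\ge 0$, $\int_{\mathbb{R}}J=1$, $J$ is positive at some negative point and at some positive point, and $a$ is Lipschitz and $2R$-periodic). *)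

theory Defs
  imports "HOL-Analysis.Analysis"
begin

definition convolution :: "(real \<Rightarrow> real) \<Rightarrow> (real \<Rightarrow> real) \<Rightarrow> real \<Rightarrow> real" where
  "convolution J u x = (LINT y|lebesgue. J (x - y) * u y)"

definition dispersal :: "(real \<Rightarrow> real) \<Rightarrow> (real \<Rightarrow> real) \<Rightarrow> real \<Rightarrow> real" where
  "dispersal J u x = convolution J u x - u x"

definition C_per :: "real \<Rightarrow> (real \<Rightarrow> real) set" where
  "C_per R = {\<phi>. continuous_on UNIV \<phi> \<and> (\<forall>x. \<phi> (x + 2 * R) = \<phi> x)}"

text \<open>
  The principal eigenvalue of \<open>- (dispersal J + a)\<close> in \<open>C_per R\<close>, as a predicate on \<open>l\<close>. Uniqueness
  of \<open>l\<close> is not built in: for the kernels and coefficients of interest it is a theorem that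
  exactly one \<open>l\<close> has this property.
\<close>
definition is_principal_eigenvalue ::
    "real \<Rightarrow> (real \<Rightarrow> real) \<Rightarrow> (real \<Rightarrow> real) \<Rightarrow> real \<Rightarrow> bool" where
  "is_principal_eigenvalue R J a l \<longleftrightarrow>
     (\<exists>\<phi>\<in>C_per R. (\<forall>x. \<phi> x > 0) \<and> (\<forall>x. dispersal J \<phi> x + a x * \<phi> x = - l * \<phi> x))"

text \<open>
  Solutions are pointwise nonnegative and bounded representatives, not necessarily continuous;
  the equation, periodicity and vanishing are all understood almost everywhere.
\<close>
definition is_solution ::
    "(real \<Rightarrow> real) \<Rightarrow> (real \<Rightarrow> real \<Rightarrow> real) \<Rightarrow> (real \<Rightarrow> real) \<Rightarrow> bool" where
  "is_solution J f u \<longleftrightarrow>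
     u \<in> borel_measurable lebesgue \<and> (\<forall>x. u x \<ge> 0) \<and> bounded (range u) \<and>
     (AE x in lebesgue. dispersal J u x + f x (u x) = 0)"

definition ae_periodic :: "real \<Rightarrow> (real \<Rightarrow> real) \<Rightarrow> bool" where
  "ae_periodic p u \<longleftrightarrow> (AE x in lebesgue. u (x + p) = u x)"

definition ae_zero :: "(real \<Rightarrow> real) \<Rightarrow> bool" where
  "ae_zero u \<longleftrightarrow> (AE x in lebesgue. u x = 0)"

end

theory Submission imports Defs begin

text \<open>
  If \<open>\<lambda>\<^sub>1 < 0\<close>, a small multiple of the principal eigenfunction \<open>\<phi>\<close> is a subsolution and the
  constant \<open>M\<close> is a supersolution. Since \<open>u \<mapsto> f x u / u\<close> decreases, the equation \<open>v - f x v = c\<close> has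
  exactly one positive root for \<open>0 < c \<le> M\<close>, which depends monotonically on \<open>c\<close>; iterating
  \<open>c = J \<star> u\<close> from \<open>M\<close> gives a decreasing sequence that stays above the subsolution, and dominated
  convergence shows that its pointwise limit is a solution.

  If \<open>\<lambda>\<^sub>1 \<ge> 0\<close> and \<open>u\<close> is a solution with \<open>u \<le> k \<phi>\<close>, then, by periodicity, \<open>f x u / u\<close> lies below
  \<open>f\<^sub>u x 0\<close> by a uniform gap wherever \<open>u \<ge> s > 0\<close>. Comparing the equations of \<open>u\<close> and \<open>\<phi>\<close> improves
  the bound there to \<open>u \<le> q k \<phi>\<close> with \<open>q < 1\<close> independent of \<open>k\<close>, so the least admissible \<open>k\<close> is 0.
\<close>

section \<open>Periodic functions and compactness\<close>

lemma periodic_reduce: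
  fixes g :: "real \<Rightarrow> 'a"
  assumes "p > 0" and per: "\<And>x. g (x + p) = g x"
  obtains y where "y \<in> {0..p}" "g y = g x"
proof -
  interpret periodic_fun_simple g p
    by unfold_locales (rule per)
  define y where "y = x - of_int \<lfloor>x / p\<rfloor> * p"
  have "y \<in> {0..p}"
    using floor_divide_lower[OF \<open>p > 0\<close>, of x] floor_divide_upper[OF \<open>p > 0\<close>, of x]
    by (simp add: y_def distrib_right)
  moreover have "g y = g x"
    unfolding y_def by (rule minus_of_int)
  ultimately show ?thesis
    by (rule that)
qed

lemma periodic_attains_inf:
  fixes g :: "real \<Rightarrow> real"
  assumes "p > 0" and cont: "continuous_on UNIV g" and per: "\<And>x. g (x + p) = g x"
  obtains x0 where "\<And>x. g x0 \<le> g x"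
proof -
  have "\<exists>x0\<in>{0..p}. \<forall>y\<in>{0..p}. g x0 \<le> g y"
    using \<open>p > 0\<close> by (intro continuous_attains_inf continuous_on_subset[OF cont]) auto
  then obtain x0 where "\<And>y. y \<in> {0..p} \<Longrightarrow> g x0 \<le> g y"
    by blast
  then show ?thesis
    using periodic_reduce[of p g, OF \<open>p > 0\<close> per] that by metis
qed

text \<open>A Dini-type argument: the open sets where \<open>g n\<close> is positive increase with
  \<open>n\<close> and cover \<open>K\<close>, so the largest index of a finite subcover serves all
  of \<open>K\<close>.\<close>

lemma incseq_uniformly_pos_on_compact:
  fixes g :: "nat \<Rightarrow> 'a::topological_space \<Rightarrow> real"
  assumes "compact K" and cont: "\<And>n. continuous_on UNIV (g n)"
    and mono: "\<And>m n x. m \<le> n \<Longrightarrow> g m x \<le> g n x"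
    and pos: "\<And>x. x \<in> K \<Longrightarrow> \<exists>n. g n x > 0"
  obtains n where "\<And>x. x \<in> K \<Longrightarrow> g n x > 0"
proof -
  have op: "open {x. 0 < g n x}" for n
    using cont[of n] by (intro open_Collect_less) auto
  have "K \<subseteq> (\<Union>n\<in>UNIV. {x. 0 < g n x})"
    using pos by blast
  from compactE_image[OF \<open>compact K\<close> op this]
  obtain C where C: "finite C" "K \<subseteq> (\<Union>n\<in>C. {x. 0 < g n x})"
    by metis
  have "0 < g (Max (insert 0 C)) x" if "x \<in> K" for x
  proof -
    obtain n where "n \<in> C" "0 < g n x"
      using C \<open>x \<in> K\<close> by blast
    moreover have "n \<le> Max (insert 0 C)"
      using C \<open>n \<in> C\<close> by simp
    ultimately show ?thesis
      using mono[of n "Max (insert 0 C)" x] by linarith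
  qed
  then show ?thesis
    using that by blast
qed

section \<open>Convolution with a continuous probability density\<close>

locale probability_kernel =
  fixes J :: "real \<Rightarrow> real"
  assumes J_cont: "continuous_on UNIV J"
    and J_nonneg: "\<And>x. J x \<ge> 0"
    and J_int: "has_bochner_integral lebesgue J 1"
begin

lemma J_borel [measurable]: "J \<in> borel_measurable borel"
  using J_cont by (rule borel_measurable_continuous_onI)

lemma J_reflect:
  "integrable lebesgue (\<lambda>y. J (x - y))" "(LINT y|lebesgue. J (x - y)) = 1"
proof -
  have J: "integrable lborel J" "integral\<^sup>L lborel J = 1"
    using J_int by (auto simp: has_bochner_integral_iff integrable_completion integral_completion)
  have "integrable lborel (\<lambda>y. J (x + (-1) * y))"
    by (rule lborel_integrable_real_affine) (use J in auto)
  then show "integrable lebesgue (\<lambda>y. J (x - y))"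
    by (simp add: integrable_completion)
  have "integral\<^sup>L lborel J = \<bar>-1\<bar> *\<^sub>R (LINT y|lborel. J (x + (-1) * y))"
    by (rule lborel_integral_real_affine) simp
  then show "(LINT y|lebesgue. J (x - y)) = 1"
    using J by (simp add: integral_completion)
qed

lemma convolution_integrable:
  assumes [measurable]: "u \<in> borel_measurable lebesgue" and "\<And>y. \<bar>u y\<bar> \<le> B"
  shows "integrable lebesgue (\<lambda>y. J (x - y) * u y)"
proof (rule Bochner_Integration.integrable_bound)
  show "integrable lebesgue (\<lambda>y. B * J (x - y))"
    using J_reflect by simp
  have [measurable]: "(\<lambda>y. J (x - y)) \<in> borel_measurable lebesgue"
    by (rule borel_measurable_integrable) (rule J_reflect)
  show "(\<lambda>y. J (x - y) * u y) \<in> borel_measurable lebesgue"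
    by measurable
  have "norm (J (x - y) * u y) \<le> norm (B * J (x - y))" for y
    using assms(2)[of y] J_nonneg[of "x - y"]
    by (simp add: abs_mult mult.commute mult_right_mono)
  then show "AE y in lebesgue. norm (J (x - y) * u y) \<le> norm (B * J (x - y))"
    by simp
qed

lemma convolution_const: "convolution J (\<lambda>_. c) x = c"
  by (simp add: convolution_def J_reflect)

lemma convolution_cmult: "convolution J (\<lambda>y. c * u y) x = c * convolution J u x"
  by (simp add: convolution_def mult.left_commute)

lemma convolution_nonneg: "(\<And>y. 0 \<le> u y) \<Longrightarrow> 0 \<le> convolution J u x"
  unfolding convolution_def by (rule Bochner_Integration.integral_nonneg) (simp add: J_nonneg)

text \<open>Integrals ignore null sets, so an almost everywhere bound on the functions becomes a
  bound on the convolutions at every point.\<close>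

lemma convolution_mono_AE:
  assumes "u \<in> borel_measurable lebesgue" "\<And>y. \<bar>u y\<bar> \<le> B"
    and "v \<in> borel_measurable lebesgue" "\<And>y. \<bar>v y\<bar> \<le> C"
    and "AE y in lebesgue. u y \<le> v y"
  shows "convolution J u x \<le> convolution J v x"
  unfolding convolution_def
  using assms
  by (intro integral_mono_AE convolution_integrable) (auto intro: mult_left_mono J_nonneg)

text \<open>Passing to \<open>lborel\<close> gives access to measurability of parametrised integrals
  and to affine substitution.\<close>

lemma convolution_lborel:
  assumes [measurable]: "u \<in> borel_measurable borel"
  shows "convolution J u x = (LINT y|lborel. J (x - y) * u y)"
  unfolding convolution_def by (rule integral_completion) measurable

lemma convolution_borel:
  assumes [measurable]: "u \<in> borel_measurable borel"
  shows "convolution J u \<in> borel_measurable borel"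
proof -
  have "(\<lambda>x. LINT y|lborel. J (x - y) * u y) \<in> borel_measurable borel"
    by measurable
  then show ?thesis
    using convolution_lborel[OF assms] by presburger
qed

lemma convolution_periodic:
  assumes [measurable]: "u \<in> borel_measurable borel" and per: "\<And>y. u (y + p) = u y"
  shows "convolution J u (x + p) = convolution J u x"
proof -
  have "convolution J u (x + p) = (LINT y|lborel. J (x + p - (p + 1 * y)) * u (p + 1 * y))"
    unfolding convolution_lborel[OF assms(1)]
    using lborel_integral_real_affine[of 1 "\<lambda>y. J (x + p - y) * u y" p] by simp
  also have "\<dots> = convolution J u x"
    unfolding convolution_lborel[OF assms(1)] using per by (simp add: add.commute)
  finally show ?thesis .
qed

lemma convolution_tendsto:
  assumes meas: "\<And>n. u n \<in> borel_measurable lebesgue" and bd: "\<And>n y. \<bar>u n y\<bar> \<le> B"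
    and lim: "\<And>y. (\<lambda>n. u n y) \<longlonglongrightarrow> v y"
  shows "(\<lambda>n. convolution J (u n) x) \<longlonglongrightarrow> convolution J v x"
  unfolding convolution_def
proof (rule integral_dominated_convergence)
  have v: "v \<in> borel_measurable lebesgue"
    using meas lim by (rule borel_measurable_LIMSEQ_real[rotated])
  have "\<bar>v y\<bar> \<le> B" for y
    using LIMSEQ_le_const2[OF tendsto_rabs[OF lim[of y]]] bd by blast
  then show "(\<lambda>y. J (x - y) * v y) \<in> borel_measurable lebesgue"
    using convolution_integrable[OF v] by blast
  show "(\<lambda>y. J (x - y) * u n y) \<in> borel_measurable lebesgue" for n
    using convolution_integrable[OF meas bd] by blast
  show "integrable lebesgue (\<lambda>y. B * J (x - y))"
    using J_reflect by simp
  show "AE y in lebesgue. (\<lambda>n. J (x - y) * u n y) \<longlonglongrightarrow> J (x - y) * v y"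
    using lim by (simp add: tendsto_mult_left)
  show "AE y in lebesgue. norm (J (x - y) * u n y) \<le> B * J (x - y)" for n
    using bd J_nonneg by (simp add: abs_mult mult.commute mult_right_mono)
qed

end

section \<open>The nonlinearity and its quotient by the density\<close>

text \<open>Here \<open>p\<close> stands for the period 2R and \<open>a\<close> for the coefficient
  f_u(x,0) of the linearisation.\<close>

locale periodic_kpp = probability_kernel J
  for J :: "real \<Rightarrow> real" +
  fixes p M :: real and f :: "real \<Rightarrow> real \<Rightarrow> real" and a :: "real \<Rightarrow> real"
  assumes p_pos: "p > 0"
    and f_cont: "continuous_on (UNIV \<times> {0..}) (\<lambda>(x, u). f x u)"
    and f_deriv0: "\<And>x. (f x has_real_derivative a x) (at 0 within {0..})"
    and f_per: "\<And>u x. u \<ge> 0 \<Longrightarrow> f (x + p) u = f x u"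
    and a_cont: "continuous_on UNIV a"
    and f_zero: "\<And>x. f x 0 = 0"
    and f_decr: "\<And>x u v. 0 < u \<Longrightarrow> u < v \<Longrightarrow> f x v / v < f x u / u"
    and M_pos: "M > 0"
    and f_M: "\<And>x. f x M \<le> 0"
begin

lemma f_cont_x: "0 \<le> u \<Longrightarrow> continuous_on UNIV (\<lambda>x. f x u)"
  using continuous_on_compose2[OF f_cont, of UNIV "\<lambda>x. (x, u)"]
  by (simp add: image_subset_iff continuous_on_Pair)

lemma f_cont_u: "continuous_on {0..} (f x)"
  using continuous_on_compose2[OF f_cont, of "{0..}" "\<lambda>u. (x, u)"]
  by (simp add: image_subset_iff continuous_on_Pair)

lemma quotient_tendsto: "((\<lambda>u. f x u / u) \<longlongrightarrow> a x) (at_right 0)"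
proof -
  have "((\<lambda>u. (f x u - f x 0) / (u - 0)) \<longlongrightarrow> a x) (at 0 within {0..})"
    using f_deriv0[of x] by (simp only: has_field_derivative_iff)
  then have "((\<lambda>u. f x u / u) \<longlongrightarrow> a x) (at 0 within {0..})"
    by (simp add: f_zero)
  then show ?thesis
    by (rule tendsto_within_subset) auto
qed

text \<open>The quotient decreases in \<open>u\<close> and tends to \<open>a x\<close> at 0, so it
  is at most \<open>a x\<close>; comparison with its value at \<open>u / 2\<close> makes the
  inequality strict.\<close>

lemma quotient_less:
  assumes "u > 0"
  shows "f x u / u < a x"
proof -
  have "eventually (\<lambda>v. f x (u / 2) / (u / 2) \<le> f x v / v) (at_right 0)"
    unfolding eventually_at_right_field
    using f_decr[of _ "u / 2" x] assms by (intro exI[of _ "u / 2"]) (auto intro: less_imp_le)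
  then have "f x (u / 2) / (u / 2) \<le> a x"
    by (rule tendsto_lowerbound[OF quotient_tendsto]) simp
  moreover have "f x u / u < f x (u / 2) / (u / 2)"
    using assms by (intro f_decr) auto
  ultimately show ?thesis
    by linarith
qed

lemma a_per: "a (x + p) = a x"
proof (rule tendsto_unique[OF _ quotient_tendsto])
  have "eventually (\<lambda>u. f x u / u = f (x + p) u / u) (at_right 0)"
    unfolding eventually_at_right_field using f_per by (intro exI[of _ 1]) auto
  then show "((\<lambda>u. f (x + p) u / u) \<longlongrightarrow> a x) (at_right 0)"
    using quotient_tendsto[of x] by (rule Lim_transform_eventually[rotated])
qed simp

text \<open>At \<open>u = s\<close> the gap is a positive continuous periodic function of
  \<open>x\<close>, so its minimum is positive; monotonicity carries it to all larger
  \<open>u\<close>.\<close>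

lemma uniform_quotient_gap:
  assumes "s > 0"
  obtains d where "d > 0" "\<And>x u. s \<le> u \<Longrightarrow> f x u / u \<le> a x - d"
proof -
  have "continuous_on UNIV (\<lambda>x. a x - f x s / s)"
    using a_cont f_cont_x[of s] assms by (intro continuous_intros) auto
  moreover have "a (x + p) - f (x + p) s / s = a x - f x s / s" for x
    using a_per f_per assms by simp
  ultimately obtain x0 where x0: "\<And>x. a x0 - f x0 s / s \<le> a x - f x s / s"
    using periodic_attains_inf[OF p_pos, of "\<lambda>x. a x - f x s / s"] by blast
  show ?thesis
  proof (rule that)
    show "a x0 - f x0 s / s > 0"
      using quotient_less[OF assms, of x0] by simp
    show "f x u / u \<le> a x - (a x0 - f x0 s / s)" if "s \<le> u" for x u
      using x0[of x] f_decr[of s u x] assms that by (cases "s = u") auto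
  qed
qed

text \<open>The quotients at \<open>u = 1 / Suc n\<close> increase with \<open>n\<close> to
  \<open>a x\<close>. Compactness of one period makes this convergence uniform in \<open>x\<close>,
  and monotonicity covers all smaller \<open>u\<close>.\<close>

lemma uniform_quotient_near_0:
  assumes "d > 0"
  obtains s where "s > 0" "\<And>x u. 0 < u \<Longrightarrow> u \<le> s \<Longrightarrow> a x - d < f x u / u"
proof -
  define g where "g n x = f x (1 / Suc n) / (1 / Suc n) - a x + d" for n x
  have cont: "continuous_on UNIV (g n)" for n
    unfolding g_def using a_cont f_cont_x[of "1 / Suc n"]
    by (intro continuous_intros) auto
  have antimono: "f x v / v \<le> f x u / u" if "0 < u" "u \<le> v" for x u v
    using f_decr[of u v x] that by (cases "u = v") auto
  have "g m x \<le> g n x" if "m \<le> n" for m n x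
    unfolding g_def using antimono[of "1 / Suc n" "1 / Suc m" x] that
    by (simp add: frac_le)
  moreover have "\<exists>n. g n x > 0" for x
  proof -
    have "eventually (\<lambda>u. a x - d < f x u / u) (at_right 0)"
      using quotient_tendsto[of x] assms by (intro order_tendstoD(1)) auto
    then obtain b where "b > 0" and b: "\<And>u. 0 < u \<Longrightarrow> u < b \<Longrightarrow> a x - d < f x u / u"
      unfolding eventually_at_right_field by blast
    obtain n where "1 / Suc n < b"
      using nat_approx_posE[OF \<open>b > 0\<close>] by blast
    then have "g n x > 0"
      unfolding g_def using b[of "1 / Suc n"] by simp
    then show ?thesis ..
  qed
  ultimately obtain n where n: "\<And>x. x \<in> {0..p} \<Longrightarrow> g n x > 0"
    using incseq_uniformly_pos_on_compact[of "{0..p}" g] cont by blast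
  have per: "g n (x + p) = g n x" for x
    by (simp add: g_def a_per f_per)
  show ?thesis
  proof (rule that)
    show "1 / real (Suc n) > 0"
      by simp
    show "a x - d < f x u / u" if u: "0 < u" "u \<le> 1 / Suc n" for x u
    proof -
      have "g n x > 0"
        using periodic_reduce[of p "g n", OF p_pos per] n by metis
      then show ?thesis
        using antimono[OF u, of x] by (simp add: g_def)
    qed
  qed
qed

section \<open>The equation with frozen convolution term\<close>

text \<open>Factor \<open>v - f x v\<close> as \<open>v * (1 - f x v / v)\<close>. Where this is
  positive both factors are positive; the first increases strictly and the second does not
  decrease.\<close>

lemma kpp_strict_mono:
  assumes "0 < s" "s < v" "0 < s - f x s"
  shows "s - f x s < v - f x v"
proof -
  have "s - f x s = s * (1 - f x s / s)"
    using assms by (simp add: field_simps)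
  also have "\<dots> < v * (1 - f x s / s)"
    using assms by (intro mult_strict_right_mono) (auto simp: field_simps)
  also have "\<dots> \<le> v * (1 - f x v / v)"
    using assms f_decr[of s v x] by (intro mult_left_mono) auto
  also have "\<dots> = v - f x v"
    using assms by (simp add: field_simps)
  finally show ?thesis .
qed

text \<open>
  Solving for \<open>u\<close> the equation with the convolution term frozen to \<open>c\<close> needs no Lipschitz bound
  on \<open>f x\<close>, unlike the usual iteration that adds a large multiple of \<open>u\<close> to both sides.
\<close>
definition response :: "real \<Rightarrow> real \<Rightarrow> real" where
  "response x c = (THE v. 0 < v \<and> v - f x v = c)"

text \<open>\<open>v - f x v\<close> is 0 at 0 and at least \<open>M\<close> at \<open>M\<close>, so
  the intermediate value theorem gives a root, nonzero because \<open>c > 0\<close>. Two positive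
  roots cannot differ, by strict growth beyond the smaller one.\<close>

lemma response:
  assumes "0 < c" "c \<le> M"
  shows "0 < response x c" "response x c - f x (response x c) = c"
proof -
  have "continuous_on {0..M} (\<lambda>v. v - f x v)"
    by (intro continuous_intros continuous_on_subset[OF f_cont_u]) auto
  moreover have "0 - f x 0 \<le> c" "c \<le> M - f x M" "0 \<le> M"
    using assms M_pos f_zero[of x] f_M[of x] by linarith+
  ultimately obtain v where v: "0 \<le> v" "v \<le> M" "v - f x v = c"
    using IVT'[of "\<lambda>v. v - f x v" 0 c M] by blast
  then have "v \<noteq> 0"
    using f_zero assms(1) by fastforce
  then have "0 < v \<and> v - f x v = c"
    using v by simp
  moreover have "w = v" if "0 < w \<and> w - f x w = c" for w
  proof (cases v w rule: linorder_cases)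
    case less
    then show ?thesis
      using kpp_strict_mono[of v w x] that v \<open>v \<noteq> 0\<close> assms(1) by linarith
  next
    case greater
    then show ?thesis
      using kpp_strict_mono[of w v x] that v assms(1) by linarith
  qed simp
  ultimately have "0 < response x c \<and> response x c - f x (response x c) = c"
    unfolding response_def by (rule theI)
  then show "0 < response x c" "response x c - f x (response x c) = c"
    by blast+
qed

lemma le_response:
  assumes "0 < c" "c \<le> M" "s - f x s \<le> c"
  shows "s \<le> response x c"
proof (rule leI, rule notI)
  assume "response x c < s"
  then have "c < s - f x s"
    using response[OF assms(1,2), of x] kpp_strict_mono[of "response x c" s x] assms(1) by metis
  then show False
    using assms(3) by linarith
qed

lemma response_le:
  assumes "0 < c" "c \<le> M" "0 < s" "c \<le> s - f x s"
  shows "response x c \<le> s"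
proof (rule leI, rule notI)
  assume "s < response x c"
  moreover have "0 < s - f x s"
    using assms by linarith
  ultimately have "s - f x s < c"
    using response[OF assms(1,2), of x] kpp_strict_mono[of s "response x c" x] assms(3) by metis
  then show False
    using assms(4) by linarith
qed

text \<open>For \<open>s > 0\<close>, comparison turns the sublevel set of this implicitly defined
  function into the explicit Borel set \<open>c x \<le> s - f x s\<close>; for
  \<open>s \<le> 0\<close> it is empty.\<close>

lemma response_measurable:
  assumes [measurable]: "c \<in> borel_measurable borel" and c: "\<And>x. 0 < c x" "\<And>x. c x \<le> M"
  shows "(\<lambda>x. response x (c x)) \<in> borel_measurable borel"
proof (rule borel_measurableI_le)
  fix s :: real
  show "{x \<in> space borel. response x (c x) \<le> s} \<in> sets borel"
  proof (cases "s > 0")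
    case True
    have [measurable]: "(\<lambda>x. f x s) \<in> borel_measurable borel"
      using f_cont_x[of s] True by (intro borel_measurable_continuous_onI) auto
    have "response x (c x) \<le> s \<longleftrightarrow> c x \<le> s - f x s" for x
    proof
      show "c x \<le> s - f x s" if "response x (c x) \<le> s"
        using kpp_strict_mono[of "response x (c x)" s x] response[OF c, of x x] c(1)[of x] that
        by (metis less_eq_real_def)
    qed (use response_le c True in blast)
    then have "{x \<in> space borel. response x (c x) \<le> s} = {x \<in> space borel. c x \<le> s - f x s}"
      by simp
    also have "\<dots> \<in> sets borel"
      by measurable
    finally show ?thesis .
  next
    case False
    then have "{x \<in> space borel. response x (c x) \<le> s} = {}"
      using response(1)[OF c] by (smt (verit) Collect_empty_eq)
    then show ?thesis
      by simp
  qed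
qed

section \<open>Monotone iteration and existence\<close>

primrec iterate :: "nat \<Rightarrow> real \<Rightarrow> real" where
  "iterate 0 = (\<lambda>_. M)"
| "iterate (Suc n) = (\<lambda>x. response x (convolution J (iterate n) x))"

text \<open>The iterates decrease from the supersolution \<open>M\<close> and stay above
  \<open>w\<close>. The lower bound \<open>m\<close> keeps their convolutions positive, so that
  \<open>response\<close> is a genuine root; periodicity comes from the constant start.\<close>

lemma solution_above_subsolution:
  assumes w [measurable]: "w \<in> borel_measurable borel"
    and m: "0 < m" "\<And>x. m \<le> w x" and w_M: "\<And>x. w x \<le> M"
    and sub: "\<And>x. w x - f x (w x) \<le> convolution J w x"
  obtains u where "u \<in> borel_measurable borel" "\<And>x. u (x + p) = u x"
    "\<And>x. w x \<le> u x" "\<And>x. u x \<le> M" "\<And>x. dispersal J u x + f x (u x) = 0"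
proof -
  have conv: "m \<le> convolution J v x" "convolution J v x \<le> M"
      "convolution J w x \<le> convolution J v x"
    if v: "v \<in> borel_measurable borel" "\<And>x. w x \<le> v x" "\<And>x. v x \<le> M" for v x
  proof -
    have abs: "\<bar>v y\<bar> \<le> M" "\<bar>w y\<bar> \<le> M" for y
      using m(1) m(2)[of y] v(2)[of y] v(3)[of y] w_M[of y] by linarith+
    have meas: "v \<in> borel_measurable lebesgue" "w \<in> borel_measurable lebesgue"
      using v(1) w by (auto intro: measurable_completion)
    show "convolution J w x \<le> convolution J v x"
      by (rule convolution_mono_AE[OF meas(2) abs(2) meas(1) abs(1)]) (simp add: v)
    have "convolution J (\<lambda>_. m) x \<le> convolution J v x"
      by (rule convolution_mono_AE[OF _ order_refl meas(1) abs(1)])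
         (auto intro: order_trans[OF m(2) v(2)])
    then show "m \<le> convolution J v x"
      by (simp add: convolution_const)
    have "convolution J v x \<le> convolution J (\<lambda>_. M) x"
      by (rule convolution_mono_AE[OF meas(1) abs(1) _ order_refl]) (simp_all add: v)
    then show "convolution J v x \<le> M"
      by (simp add: convolution_const)
  qed
  have step: "iterate n \<in> borel_measurable borel \<and>
      (\<forall>x. iterate n (x + p) = iterate n x \<and> w x \<le> iterate n x \<and> iterate n x \<le> M)" for n
  proof (induction n)
    case 0
    then show ?case
      using w_M by simp
  next
    case (Suc n)
    then have IH: "iterate n \<in> borel_measurable borel" "\<And>x. iterate n (x + p) = iterate n x"
        "\<And>x. w x \<le> iterate n x" "\<And>x. iterate n x \<le> M"
      by auto
    note c = conv[OF IH(1,3,4)]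
    have c0: "0 < convolution J (iterate n) x" for x
      using c(1)[of x] m by linarith
    have "iterate (Suc n) \<in> borel_measurable borel"
      using response_measurable[OF convolution_borel[OF IH(1)] c0 c(2)] by simp
    moreover have "iterate (Suc n) (x + p) = iterate (Suc n) x" for x
    proof -
      have "(0 < v \<and> v - f (x + p) v = d) \<longleftrightarrow> (0 < v \<and> v - f x v = d)" for v d
        using f_per[of v x] by auto
      then show ?thesis
        using convolution_periodic[OF IH(1,2)] by (simp add: response_def)
    qed
    moreover have "w x \<le> iterate (Suc n) x" for x
      using le_response[OF c0 c(2) order_trans[OF sub c(3)], of x] by simp
    moreover have "iterate (Suc n) x \<le> M" for x
    proof -
      have "convolution J (iterate n) x \<le> M - f x M"
        using c(2)[of x] f_M[of x] by linarith
      then show ?thesis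
        using response_le[OF c0 c(2) M_pos] by simp
    qed
    ultimately show ?case
      by blast
  qed
  then have meas: "iterate n \<in> borel_measurable borel"
    and per: "iterate n (x + p) = iterate n x"
    and ge: "w x \<le> iterate n x" and le: "iterate n x \<le> M" for n x
    by auto
  have lmeas: "iterate n \<in> borel_measurable lebesgue" for n
    using meas by (auto intro: measurable_completion)
  have abs: "\<bar>iterate n x\<bar> \<le> M" for n x
    using m(1) m(2)[of x] ge[of x n] le[of n x] by linarith
  note c = conv[OF meas ge le]
  have c0: "0 < convolution J (iterate n) x" for n x
    using c(1)[of n x] m by linarith
  have eq: "iterate (Suc n) x - f x (iterate (Suc n) x) = convolution J (iterate n) x" for n x
    using response(2)[OF c0 c(2)] by simp
  have "iterate (Suc n) x \<le> iterate n x" for n x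
  proof (induction n arbitrary: x)
    case 0
    then show ?case
      using le[of 1 x] by simp
  next
    case (Suc n)
    have "convolution J (iterate (Suc n)) x \<le> convolution J (iterate n) x"
      by (rule convolution_mono_AE[OF lmeas abs lmeas abs]) (simp only: Suc.IH AE_I2)
    moreover have "0 < iterate (Suc n) x"
      using m(1) m(2)[of x] ge[of x "Suc n"] by linarith
    ultimately have "response x (convolution J (iterate (Suc n)) x) \<le> iterate (Suc n) x"
      using eq by (intro response_le[OF c0 c(2)]) (auto simp del: iterate.simps)
    then show ?case
      by (simp only: iterate.simps)
  qed
  then have "decseq (\<lambda>n. iterate n x)" for x
    by (intro decseq_SucI)
  then have "\<exists>l. (\<lambda>n. iterate n x) \<longlonglongrightarrow> l" for x
    using ge decseq_convergent[of "\<lambda>n. iterate n x" "w x"] by metis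
  then obtain u where u: "\<And>x. (\<lambda>n. iterate n x) \<longlonglongrightarrow> u x"
    by metis
  show ?thesis
  proof (rule that)
    show "u \<in> borel_measurable borel"
      using u meas by (rule borel_measurable_LIMSEQ_real)
    show "u (x + p) = u x" for x
      using u[of "x + p"] u[of x] by (simp only: per LIMSEQ_unique)
    show wu: "w x \<le> u x" for x
      using LIMSEQ_le_const[OF u] ge by blast
    show "u x \<le> M" for x
      using LIMSEQ_le_const2[OF u] le by blast
    show "dispersal J u x + f x (u x) = 0" for x
    proof -
      \<comment> \<open>Continuity of \<open>f x\<close> is available on \<open>{0..}\<close>, so
        the iterates and their limit must lie there before passing to the limit in
        \<open>eq\<close>.\<close>
      have pos: "0 \<le> iterate n x" for n
        using m(1) m(2)[of x] ge[of x n] by linarith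
      have "0 \<le> u x"
        using m(1) m(2)[of x] wu[of x] by linarith
      then have "(\<lambda>n. f x (iterate (Suc n) x)) \<longlonglongrightarrow> f x (u x)"
        using pos by (intro continuous_on_tendsto_compose[OF f_cont_u LIMSEQ_Suc[OF u]]) 
          (auto simp del: iterate.simps)
      then have "(\<lambda>n. convolution J (iterate n) x) \<longlonglongrightarrow> u x - f x (u x)"
        unfolding eq[symmetric] by (intro tendsto_diff LIMSEQ_Suc[OF u])
      moreover have "(\<lambda>n. convolution J (iterate n) x) \<longlonglongrightarrow> convolution J u x"
        using lmeas abs u by (rule convolution_tendsto)
      ultimately show ?thesis
        using LIMSEQ_unique by (fastforce simp: dispersal_def)
    qed
  qed
qed

text \<open>Since \<open>l < 0\<close>, the quotient exceeds \<open>a x + l\<close> for all small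
  \<open>u\<close>, which makes a small multiple of \<open>\<phi>\<close> a subsolution with a
  positive minimum.\<close>

lemma nontrivial_solution_exists:
  assumes \<phi>: "continuous_on UNIV \<phi>" "\<And>x. \<phi> (x + p) = \<phi> x" "\<And>x. 0 < \<phi> x"
    and eig: "\<And>x. dispersal J \<phi> x + a x * \<phi> x = - l * \<phi> x" and "l < 0"
  shows "\<exists>u. is_solution J f u \<and> ae_periodic p u \<and> \<not> ae_zero u"
proof -
  obtain x0 where x0: "\<And>x. \<phi> x0 \<le> \<phi> x"
    using periodic_attains_inf[OF p_pos \<phi>(1,2)] by blast
  obtain x1 where x1: "\<And>x. \<phi> x \<le> \<phi> x1"
    using periodic_attains_inf[of p "\<lambda>x. - \<phi> x"] p_pos \<phi>(1,2)
    by (auto intro: continuous_on_minus)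
  obtain s where "s > 0" and s: "\<And>x u. 0 < u \<Longrightarrow> u \<le> s \<Longrightarrow> a x - (- l) < f x u / u"
    using uniform_quotient_near_0[of "- l"] \<open>l < 0\<close> by auto
  \<comment> \<open>This scaling gives \<open>e * \<phi>\<close> the maximum \<open>min s M\<close>:
    small enough for the quotient estimate and below the supersolution.\<close>
  define e where "e = min s M / \<phi> x1"
  have "e > 0"
    using \<open>s > 0\<close> M_pos \<phi>(3) by (simp add: e_def)
  have e: "0 < e * \<phi> x" "e * \<phi> x \<le> min s M" for x
  proof -
    show "0 < e * \<phi> x"
      using \<open>e > 0\<close> \<phi>(3) by simp
    have "e * \<phi> x \<le> e * \<phi> x1"
      using \<open>e > 0\<close> x1 by simp
    also have "\<dots> = min s M"
      using \<phi>(3)[of x1] by (simp add: e_def)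
    finally show "e * \<phi> x \<le> min s M" .
  qed
  have "e * \<phi> x - f x (e * \<phi> x) \<le> convolution J (\<lambda>x. e * \<phi> x) x" for x
  proof -
    have "(a x + l) * (e * \<phi> x) \<le> f x (e * \<phi> x)"
      using s[of "e * \<phi> x" x] e[of x] by (simp add: pos_less_divide_eq less_imp_le)
    moreover have "e * (convolution J \<phi> x - \<phi> x + a x * \<phi> x) = e * (- l * \<phi> x)"
      using eig[of x] by (simp add: dispersal_def)
    ultimately show ?thesis
      unfolding convolution_cmult by (simp add: algebra_simps)
  qed
  moreover have "(\<lambda>x. e * \<phi> x) \<in> borel_measurable borel"
    using \<phi>(1) by (intro borel_measurable_continuous_onI continuous_intros)
  moreover have "e * \<phi> x0 \<le> e * \<phi> x" for x
    using \<open>e > 0\<close> x0 by simp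
  ultimately obtain u where u: "u \<in> borel_measurable borel" "\<And>x. u (x + p) = u x"
      "\<And>x. e * \<phi> x \<le> u x" "\<And>x. u x \<le> M" "\<And>x. dispersal J u x + f x (u x) = 0"
    using solution_above_subsolution[of "\<lambda>x. e * \<phi> x" "e * \<phi> x0"] e by (metis min.boundedE)
  have pos: "u x > 0" for x
    using u(3) e(1) less_le_trans by blast
  have "bounded (range u)"
    unfolding bounded_iff using pos u(4) by (auto intro!: exI[of _ M] simp: abs_of_pos)
  then have "is_solution J f u"
    using u pos by (auto simp: is_solution_def less_imp_le intro: measurable_completion)
  moreover have "\<not> ae_zero u"
  proof
    assume "ae_zero u"
    then have "AE x::real in lebesgue. False"
      unfolding ae_zero_def using pos by (simp add: less_imp_neq[symmetric])
    then show False
      unfolding eventually_False by (simp add: ae_filter_eq_bot_iff)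
  qed
  ultimately show ?thesis
    using u(2) by (auto simp: ae_periodic_def)
qed

section \<open>Vanishing of solutions for nonnegative eigenvalue\<close>

text \<open>Where \<open>u \<ge> s\<close>, the equations of \<open>u\<close> and
  \<open>\<phi>\<close> give \<open>(m + d) * u x \<le> m * (k * \<phi> x)\<close> with
  \<open>m = 1 - a x - l\<close>. The factor m/(m+d) is bounded away from 1 because \<open>m\<close>
  is bounded above.\<close>

lemma solution_bound_contracts:
  assumes \<phi>: "continuous_on UNIV \<phi>" "\<And>x. \<phi> (x + p) = \<phi> x" "\<And>x. 0 < \<phi> x"
    and eig: "\<And>x. dispersal J \<phi> x + a x * \<phi> x = - l * \<phi> x" and "l \<ge> 0"
    and u: "is_solution J f u" and "s > 0"
  obtains q where "0 < q" "q < 1"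
    "\<And>k. 0 < k \<Longrightarrow> AE x in lebesgue. u x \<le> k * \<phi> x \<Longrightarrow>
      AE x in lebesgue. u x < s \<or> u x \<le> q * k * \<phi> x"
proof -
  obtain d where "d > 0" and d: "\<And>x v. s \<le> v \<Longrightarrow> f x v / v \<le> a x - d"
    using uniform_quotient_gap[OF \<open>s > 0\<close>] by blast
  obtain x1 where x1: "\<And>x. \<phi> x \<le> \<phi> x1"
    using periodic_attains_inf[of p "\<lambda>x. - \<phi> x"] p_pos \<phi>(1,2)
    by (auto intro: continuous_on_minus)
  obtain x2 where x2: "\<And>x. a x2 \<le> a x"
    using periodic_attains_inf[OF p_pos a_cont a_per] by blast
  have conv_\<phi>: "convolution J \<phi> x = (1 - a x - l) * \<phi> x" for x
    using eig[of x] by (simp add: dispersal_def algebra_simps)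
  \<comment> \<open>\<open>c\<close> bounds \<open>m\<close> from above uniformly in
    \<open>x\<close>, and the maximum with 1 keeps it positive; \<open>q\<close> is the value of
    t/(t+d) at \<open>t = c\<close>.\<close>
  define c where "c = max 1 (1 - a x2 - l)"
  define q where "q = c / (c + d)"
  have c: "c > 0" "1 - a x - l \<le> c" for x
    unfolding c_def using x2[of x] by linarith+
  have \<phi>_meas: "\<phi> \<in> borel_measurable lebesgue"
    using \<phi>(1) by (intro measurable_completion) (simp add: borel_measurable_continuous_onI)
  have u_meas: "u \<in> borel_measurable lebesgue" and "bounded (range u)"
    and u_eq: "AE x in lebesgue. dispersal J u x + f x (u x) = 0"
    using u by (auto simp: is_solution_def)
  then obtain B where B: "\<And>x. \<bar>u x\<bar> \<le> B"
    unfolding bounded_iff by auto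
  show ?thesis
  proof (rule that)
    show "0 < q" "q < 1"
      using c \<open>d > 0\<close> by (auto simp: q_def)
    fix k :: real
    assume "0 < k" and k: "AE x in lebesgue. u x \<le> k * \<phi> x"
    have conv: "convolution J u x \<le> k * convolution J \<phi> x" for x
      unfolding convolution_cmult[symmetric]
    proof (rule convolution_mono_AE[OF u_meas B _ _ k])
      show "\<bar>k * \<phi> y\<bar> \<le> k * \<phi> x1" for y
        using x1[of y] \<phi>(3)[of y] \<open>0 < k\<close> by (simp add: abs_mult)
    qed (use \<phi>_meas in measurable)
    show "AE x in lebesgue. u x < s \<or> u x \<le> q * k * \<phi> x"
      using u_eq
    proof eventually_elim
      case (elim x)
      show ?case
      proof (cases "u x < s")
        case False
        then have "f x (u x) \<le> (a x - d) * u x"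
          using d[of "u x" x] \<open>s > 0\<close> by (simp add: pos_divide_le_eq)
        then have "(1 - a x + d) * u x \<le> convolution J u x"
          using elim by (simp add: dispersal_def algebra_simps)
        also have "\<dots> \<le> k * ((1 - a x - l) * \<phi> x)"
          using conv[of x] unfolding conv_\<phi> .
        finally have le: "(1 - a x + d) * u x \<le> (1 - a x - l) * (k * \<phi> x)"
          by (simp add: algebra_simps)
        define m where "m = 1 - a x - l"
        have "0 \<le> l * u x"
          using False \<open>s > 0\<close> \<open>l \<ge> 0\<close> by simp
        then have m: "(m + d) * u x \<le> m * (k * \<phi> x)"
          using le by (simp add: m_def algebra_simps)
        have "0 < u x" "0 < k * \<phi> x"
          using False \<open>s > 0\<close> \<open>0 < k\<close> \<phi>(3) by auto
        \<comment> \<open>Positivity of \<open>m\<close>: the eigenvalue equation reads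
          \<open>m * \<phi> x = convolution J \<phi> x\<close>, which is nonnegative, and
          \<open>m = 0\<close> would force \<open>d * u x \<le> 0\<close>.\<close>
        have "0 \<le> m * \<phi> x"
          using conv_\<phi>[of x] convolution_nonneg[of \<phi> x] \<phi>(3)
          by (simp add: m_def less_imp_le)
        then have "0 \<le> m"
          using \<phi>(3)[of x] by (simp add: zero_le_mult_iff)
        moreover have "m \<noteq> 0"
          using m \<open>0 < u x\<close> \<open>d > 0\<close> by (auto simp: mult_le_0_iff)
        ultimately have "m > 0"
          by simp
        \<comment> \<open>Monotonicity of t/(t+d) in cross-multiplied form.\<close>
        have "m * (c + d) \<le> c * (m + d)"
          using mult_left_mono[of m c d] c(2)[of x, folded m_def] \<open>d > 0\<close>
          by (simp add: algebra_simps)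
        then have "m * (c + d) * u x \<le> c * (m + d) * u x"
          using \<open>0 < u x\<close> by (intro mult_right_mono) auto
        also have "\<dots> \<le> m * (c * (k * \<phi> x))"
          using mult_left_mono[OF m, of c] c(1) by (simp add: mult_ac)
        finally have "(c + d) * u x \<le> c * (k * \<phi> x)"
          using \<open>m > 0\<close> by (simp add: mult.assoc)
        then have "u x \<le> q * k * \<phi> x"
          using c(1) \<open>d > 0\<close> by (simp add: q_def pos_le_divide_eq mult_ac)
        then show ?thesis ..
      qed simp
    qed
  qed
qed

lemma solution_trivial:
  assumes \<phi>: "continuous_on UNIV \<phi>" "\<And>x. \<phi> (x + p) = \<phi> x" "\<And>x. 0 < \<phi> x"
    and eig: "\<And>x. dispersal J \<phi> x + a x * \<phi> x = - l * \<phi> x" and "l \<ge> 0"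
    and u: "is_solution J f u"
  shows "ae_zero u"
proof -
  obtain x0 where x0: "\<And>x. \<phi> x0 \<le> \<phi> x"
    using periodic_attains_inf[OF p_pos \<phi>(1,2)] by blast
  have "bounded (range u)"
    using u by (simp add: is_solution_def)
  then obtain B where "\<And>x. \<bar>u x\<bar> \<le> B"
    unfolding bounded_iff by auto
  then have B: "\<And>x. u x \<le> B"
    by (simp add: abs_le_iff)
  have u0: "\<And>x. 0 \<le> u x"
    using u by (auto simp: is_solution_def)
  define S where "S = {k. 0 < k \<and> (AE x in lebesgue. u x \<le> k * \<phi> x)}"
  define K where "K = Inf S"
  have "bdd_below S"
    by (rule bdd_belowI[of _ 0]) (auto simp: S_def)
  \<comment> \<open>The summand 1 keeps the multiple strictly positive even if
    \<open>B = 0\<close>.\<close>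
  have "B / \<phi> x0 + 1 \<in> S"
  proof -
    have "B \<ge> 0"
      using B u0 order_trans by blast
    then have "0 < B / \<phi> x0 + 1"
      using \<phi>(3)[of x0] by (simp add: add_nonneg_pos)
    moreover have "u x \<le> (B / \<phi> x0 + 1) * \<phi> x" for x
    proof -
      have "u x \<le> B / \<phi> x0 * \<phi> x0"
        using B[of x] \<phi>(3)[of x0] by simp
      also have "\<dots> \<le> (B / \<phi> x0 + 1) * \<phi> x"
        using x0[of x] \<phi>(3) \<open>B \<ge> 0\<close> by (intro mult_mono) (auto simp: less_imp_le)
      finally show ?thesis .
    qed
    ultimately show ?thesis
      by (simp add: S_def)
  qed
  then have "S \<noteq> {}"
    by blast
  have K_le: "K \<le> k" if "k \<in> S" for k
    unfolding K_def using that \<open>bdd_below S\<close> by (rule cInf_lower)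
  have K_approx: "\<exists>k\<in>S. k < e" if "K < e" for e
    using that cInf_lessD[OF \<open>S \<noteq> {}\<close>] by (auto simp: K_def)
  have "K \<ge> 0"
    unfolding K_def using \<open>S \<noteq> {}\<close> by (rule cInf_greatest) (auto simp: S_def)
  have "K = 0"
  proof (rule ccontr)
    assume "K \<noteq> 0"
    then have "K > 0"
      using \<open>K \<ge> 0\<close> by simp
    \<comment> \<open>With this threshold, \<open>u x < s\<close> already implies
      \<open>u x \<le> K / 2 * \<phi> x\<close>, so the contraction matters only where
      \<open>u \<ge> s\<close>.\<close>
    define s where "s = K / 2 * \<phi> x0"
    have "s > 0"
      using \<open>K > 0\<close> \<phi>(3) by (simp add: s_def)
    obtain q where "0 < q" "q < 1"
      and q: "\<And>k. 0 < k \<Longrightarrow> AE x in lebesgue. u x \<le> k * \<phi> x \<Longrightarrow>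
        AE x in lebesgue. u x < s \<or> u x \<le> q * k * \<phi> x"
      using solution_bound_contracts[OF \<phi> eig \<open>l \<ge> 0\<close> u \<open>s > 0\<close>] by blast
    \<comment> \<open>An admissible \<open>k\<close> below \<open>K / q\<close> contracts to
      \<open>q * k < K\<close>, so \<open>max (K / 2) (q * k)\<close> is admissible and smaller than
      the infimum.\<close>
    have "K < K / q"
      using \<open>K > 0\<close> \<open>0 < q\<close> \<open>q < 1\<close> by (simp add: pos_less_divide_eq)
    then obtain k where "k \<in> S" "k < K / q"
      using K_approx by blast
    then have "0 < k" and AE: "AE x in lebesgue. u x < s \<or> u x \<le> q * k * \<phi> x"
      using q by (auto simp: S_def)
    have "AE x in lebesgue. u x \<le> max (K / 2) (q * k) * \<phi> x"
      using AE
    proof eventually_elim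
      case (elim x)
      have "K / 2 * \<phi> x0 \<le> max (K / 2) (q * k) * \<phi> x"
        using x0[of x] \<phi>(3) \<open>K > 0\<close> by (intro mult_mono) (auto simp: less_imp_le)
      moreover have "q * k * \<phi> x \<le> max (K / 2) (q * k) * \<phi> x"
        using \<phi>(3) by (intro mult_right_mono) (auto simp: less_imp_le)
      ultimately show ?case
        using elim unfolding s_def by linarith
    qed
    then have "K \<le> max (K / 2) (q * k)"
      using K_le[of "max (K / 2) (q * k)"] \<open>K > 0\<close> by (auto simp: S_def)
    moreover have "q * k < K"
      using \<open>k < K / q\<close> \<open>0 < q\<close> by (simp add: pos_less_divide_eq mult.commute)
    ultimately show False
      using \<open>K > 0\<close> by (simp add: max_def split: if_splits)
  qed
  \<comment> \<open>\<open>S\<close> contains only positive multiples, so 0 is approached along a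
    sequence; countability lets the exceptional null sets be united.\<close>
  have "AE x in lebesgue. u x \<le> 1 / Suc n * \<phi> x" for n
  proof -
    obtain k where k: "k \<in> S" "k < 1 / Suc n"
      using K_approx[of "1 / Suc n"] \<open>K = 0\<close> by auto
    then have "AE x in lebesgue. u x \<le> k * \<phi> x"
      by (simp add: S_def)
    then show ?thesis
    proof eventually_elim
      case (elim x)
      have "k * \<phi> x \<le> 1 / Suc n * \<phi> x"
        using k \<phi>(3)[of x] by (intro mult_right_mono) auto
      then show ?case
        using elim by linarith
    qed
  qed
  then have "AE x in lebesgue. \<forall>n. u x \<le> 1 / Suc n * \<phi> x"
    by (simp add: AE_all_countable)
  then show ?thesis
    unfolding ae_zero_def
  proof eventually_elim
    case (elim x)
    have "(\<lambda>n. 1 / Suc n * \<phi> x) \<longlonglongrightarrow> 0 * \<phi> x"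
      by (intro tendsto_mult_right LIMSEQ_Suc lim_const_over_n)
    then have "u x \<le> 0"
      using elim LIMSEQ_le_const[of _ 0 "u x"] by auto
    then show ?case
      using u0[of x] by simp
  qed
qed

end

theorem theorem1p1:
  fixes R lam1 :: real
    and J :: "real \<Rightarrow> real"
    and f fu :: "real \<Rightarrow> real \<Rightarrow> real"
  assumes R_pos: "R > 0"
    and J_cont: "continuous_on UNIV J"
    and J_nonneg: "\<forall>x. J x \<ge> 0"
    and J_int: "has_bochner_integral lebesgue J 1"
    and J_pos: "\<exists>a b. a < 0 \<and> 0 < b \<and> J a > 0 \<and> J b > 0"
    and f_cont: "continuous_on (UNIV \<times> {0..}) (\<lambda>(x, u). f x u)"
    and f_deriv: "\<forall>x. \<forall>u\<ge>0. (f x has_real_derivative fu x u) (at u within {0..})"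
    and f_per: "\<forall>u\<ge>0. \<forall>x. f (x + 2 * R) u = f x u"
    and fu0_lipschitz: "\<exists>L. L-lipschitz_on UNIV (\<lambda>x. fu x 0)"
    and f_zero: "\<forall>x. f x 0 = 0"
    and f_decr: "\<forall>x u v. 0 < u \<longrightarrow> u < v \<longrightarrow> f x v / v < f x u / u"
    and f_nonpos: "\<exists>M>0. \<forall>u\<ge>M. \<forall>x. f x u \<le> 0"
    and lam1: "is_principal_eigenvalue R J (\<lambda>x. fu x 0) lam1"
  shows "((\<exists>u. is_solution J f u \<and> ae_periodic (2 * R) u \<and> \<not> ae_zero u) \<longleftrightarrow> lam1 < 0) \<and>
         (lam1 \<ge> 0 \<longrightarrow> (\<forall>u. is_solution J f u \<longrightarrow> ae_zero u))"
proof -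
  obtain M where "M > 0" and M: "\<And>u x. u \<ge> M \<Longrightarrow> f x u \<le> 0"
    using f_nonpos by blast
  interpret periodic_kpp J "2 * R" M f "\<lambda>x. fu x 0"
  proof
    show "continuous_on UNIV (\<lambda>x. fu x 0)"
      using fu0_lipschitz lipschitz_on_continuous_on by blast
  qed (use assms \<open>M > 0\<close> M in auto)
  obtain \<phi> where \<phi>: "continuous_on UNIV \<phi>" "\<And>x. \<phi> (x + 2 * R) = \<phi> x" "\<And>x. 0 < \<phi> x"
    "\<And>x. dispersal J \<phi> x + fu x 0 * \<phi> x = - lam1 * \<phi> x"
    using lam1 by (auto simp: is_principal_eigenvalue_def C_per_def)
  \<comment> \<open>For \<open>lam1 \<ge> 0\<close> every solution vanishes almost everywhere,
    periodic or not. This is the last claim and, by contraposition, the necessity of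
    \<open>lam1 < 0\<close>.\<close>
  show ?thesis
    using nontrivial_solution_exists[OF \<phi>] solution_trivial[OF \<phi>] by (meson not_le)
qed

end
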